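(* Let $P_n$ be the path on $n$ vertices. The sequences $(b^A_g(P_n)/n)_{n\ge1}$ and $(b^I_g(P_n)/n)_{n\ge1}$ both converge, and to the same limit.
   Context: The balance game on a finite simple graph $G$ is played by two players, Admirable (A) and Impish (I), who alternately select a not-yet-labeled vertex of $G$ until all vertices are labeled; Admirable labels each vertex she selects by $0$ and Impish labels each vertex he selects by $1$. Each edge receives the sum modulo $2$ of the labels of its endpoints. Let $e_0$ and $e_1$ be the numbers of edges labeled $0$ and $1$ at the end; the discrepancy is $d=e_1-e_0$. Admirable tries to minimize $d$ and Impish tries to maximize $d$. $b^A_g(G)$ is the value of $d$ under optimal play when Admirable moves first, and $b^I_g(G)$ is the value under optimal play when Impish moves first. *)

theory Defs
  imports Complex_Main
begin

type_synonym 'a ugraph = "'a set \<times> 'a set set"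

definition verts :: "'a ugraph \<Rightarrow> 'a set" where
  "verts G = fst G"

definition edges :: "'a ugraph \<Rightarrow> 'a set set" where
  "edges G = snd G"

definition finite_simple_graph :: "'a ugraph \<Rightarrow> bool" where
  "finite_simple_graph G \<longleftrightarrow>
     finite (verts G) \<and> (\<forall>e\<in>edges G. e \<subseteq> verts G \<and> card e = 2)"

definition path_graph :: "nat \<Rightarrow> nat ugraph" where
  "path_graph n = ({..<n}, {{i, Suc i} |i. Suc i < n})"

lemma finite_simple_graph_path_graph: "finite_simple_graph (path_graph n)"
  by (auto simp: finite_simple_graph_def path_graph_def verts_def edges_def)

datatype player = Admirable | Impish

primrec opponent :: "player \<Rightarrow> player" where
  "opponent Admirable = Impish"
| "opponent Impish = Admirable"

primrec player_label :: "player \<Rightarrow> nat" where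
  "player_label Admirable = 0"
| "player_label Impish = 1"

text \<open>A position is a partial map from vertices to labels; its domain is the set of vertices
  selected so far.\<close>

definition edge_label :: "('a \<rightharpoonup> nat) \<Rightarrow> 'a set \<Rightarrow> nat" where
  "edge_label f e = (\<Sum>v\<in>e. the (f v)) mod 2"

definition discrepancy :: "'a ugraph \<Rightarrow> ('a \<rightharpoonup> nat) \<Rightarrow> int" where
  "discrepancy G f =
     int (card {e \<in> edges G. edge_label f e = 1}) - int (card {e \<in> edges G. edge_label f e = 0})"

text \<open>Value, under optimal play, of the position \<open>f\<close> with player \<open>p\<close> to move (backward induction).
  The case of an infinite vertex set is a dummy, present only to make the function total.\<close>

function game_value :: "'a ugraph \<Rightarrow> player \<Rightarrow> ('a \<rightharpoonup> nat) \<Rightarrow> int" where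
  "game_value G p f =
     (if infinite (verts G) \<or> verts G \<subseteq> dom f then discrepancy G f
      else (case p of Admirable \<Rightarrow> Min | Impish \<Rightarrow> Max)
             ((\<lambda>v. game_value G (opponent p) (f(v \<mapsto> player_label p))) ` (verts G - dom f)))"
  by pat_completeness auto
termination
proof (relation "measure (\<lambda>(G, p, f). card (verts G - dom f))", goal_cases)
  case 1
  show ?case by simp
next
  case (2 G p f v)
  then have "verts G - dom (f(v \<mapsto> player_label p)) \<subset> verts G - dom f"
    by auto
  moreover have "finite (verts G - dom f)"
    using 2 by simp
  ultimately have "card (verts G - dom (f(v \<mapsto> player_label p))) < card (verts G - dom f)"
    by (rule psubset_card_mono[rotated])
  then show ?case by simp
qed

declare game_value.simps [simp del]

text \<open>The value when player \<open>p\<close> moves first, i.e. $b_g^A(G)$ or $b_g^I(G)$.\<close>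

definition balance_game_number :: "player \<Rightarrow> 'a ugraph \<Rightarrow> int" where
  "balance_game_number p G = game_value G p Map.empty"

end

theory Submission
  imports Defs
begin

text \<open>
  On a path, relabelling one vertex changes the discrepancy by at most 4. A strategy-stealing
  argument turns this into the statement that the right to move is worth only a bounded amount, at
  every position; in particular the two values of \<open>P\<^sub>n\<close> differ by a bounded amount.
  If \<open>P\<^sub>m\<^sub>+\<^sub>n\<close> is cut into \<open>P\<^sub>m\<close> and \<open>P\<^sub>n\<close>, Admirable can answer
  each move of Impish in the part where he has just moved; only when that part is exhausted does she
  have to move in the other one, which happens with bounded loss. Hence the value with
  Impish moving first is subadditive up to a constant, and Fekete's lemma applies.
\<close>

section \<open>Optimal moves\<close>

lemma game_value_full: "verts G \<subseteq> dom f \<Longrightarrow> game_value G p f = discrepancy G f"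
  by (simp add: game_value.simps)

lemma game_value_Admirable_le:
  assumes "finite (verts G)" "v \<in> verts G" "v \<notin> dom f"
  shows "game_value G Admirable f \<le> game_value G Impish (f(v \<mapsto> 0))"
proof -
  have "\<not> verts G \<subseteq> dom f" using assms by blast
  then have "game_value G Admirable f =
      Min ((\<lambda>v. game_value G Impish (f(v \<mapsto> 0))) ` (verts G - dom f))"
    using assms by (subst game_value.simps) simp
  also have "\<dots> \<le> game_value G Impish (f(v \<mapsto> 0))"
    using assms by (intro Min_le) auto
  finally show ?thesis .
qed

lemma game_value_Impish_ge:
  assumes "finite (verts G)" "v \<in> verts G" "v \<notin> dom f"
  shows "game_value G Admirable (f(v \<mapsto> 1)) \<le> game_value G Impish f"
proof -
  have "\<not> verts G \<subseteq> dom f" using assms by blast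
  then have "game_value G Impish f =
      Max ((\<lambda>v. game_value G Admirable (f(v \<mapsto> 1))) ` (verts G - dom f))"
    using assms by (subst game_value.simps) simp
  also have "\<dots> \<ge> game_value G Admirable (f(v \<mapsto> 1))"
    using assms by (intro Max_ge) auto
  finally show ?thesis .
qed

lemma game_value_Admirable_optimal:
  assumes "finite (verts G)" "\<not> verts G \<subseteq> dom f"
  obtains v where "v \<in> verts G" "v \<notin> dom f"
    "game_value G Admirable f = game_value G Impish (f(v \<mapsto> 0))"
proof -
  let ?A = "(\<lambda>v. game_value G Impish (f(v \<mapsto> 0))) ` (verts G - dom f)"
  have "game_value G Admirable f = Min ?A"
    using assms by (subst game_value.simps) simp
  moreover have "Min ?A \<in> ?A"
    using assms by (intro Min_in) auto
  ultimately have "game_value G Admirable f \<in> ?A" by simp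
  then show thesis by (rule imageE) (rule that, auto)
qed

lemma game_value_Impish_optimal:
  assumes "finite (verts G)" "\<not> verts G \<subseteq> dom f"
  obtains v where "v \<in> verts G" "v \<notin> dom f"
    "game_value G Impish f = game_value G Admirable (f(v \<mapsto> 1))"
proof -
  let ?A = "(\<lambda>v. game_value G Admirable (f(v \<mapsto> 1))) ` (verts G - dom f)"
  have "game_value G Impish f = Max ?A"
    using assms by (subst game_value.simps) simp
  moreover have "Max ?A \<in> ?A"
    using assms by (intro Max_in) auto
  ultimately have "game_value G Impish f \<in> ?A" by simp
  then show thesis by (rule imageE) (rule that, auto)
qed

section \<open>The value of a tempo\<close>

context
  fixes G :: "'a ugraph" and K :: int
  assumes fin: "finite (verts G)"
    and relabel: "\<And>f v x y. discrepancy G (f(v \<mapsto> x)) \<le> discrepancy G (f(v \<mapsto> y)) + K"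
begin

lemma relabel_nonneg: "0 \<le> K"
  using relabel[of Map.empty undefined 0 0] by simp

text \<open>The two positions have the same free vertices, so Admirable on the left copies her
  optimal move from the right, and Impish's optimal move on the left is copied on the right. The
  final labellings then differ at \<open>v\<close> only, where \<open>relabel\<close>
  applies.\<close>

lemma game_value_relabel:
  "game_value G p (f(v \<mapsto> x)) \<le> game_value G p (f(v \<mapsto> y)) + K"
proof (induction "card (verts G - dom (f(v \<mapsto> x)))" arbitrary: f p rule: less_induct)
  case less
  show ?case
  proof (cases "verts G \<subseteq> dom (f(v \<mapsto> x))")
    case True
    then have "verts G \<subseteq> dom (f(v \<mapsto> y))" by auto
    with True show ?thesis by (simp only: game_value_full relabel)
  next
    case nonfull: False
    then have nonfull': "\<not> verts G \<subseteq> dom (f(v \<mapsto> y))" by auto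
    have IH: "game_value G q (f(v \<mapsto> x, u \<mapsto> z)) \<le> game_value G q (f(v \<mapsto> y, u \<mapsto> z)) + K"
      if "u \<in> verts G" "u \<notin> dom (f(v \<mapsto> x))" for u z q
    proof -
      \<comment> \<open>Updates at distinct vertices commute, so the move at \<open>u\<close> can be
        absorbed into the arbitrary base position.\<close>
      have "verts G - dom (f(u \<mapsto> z, v \<mapsto> x)) \<subset> verts G - dom (f(v \<mapsto> x))" using that by auto
      then have "card (verts G - dom (f(u \<mapsto> z, v \<mapsto> x))) < card (verts G - dom (f(v \<mapsto> x)))"
        using fin by (intro psubset_card_mono) auto
      from less[OF this, of q] have "game_value G q (f(u \<mapsto> z, v \<mapsto> x))
          \<le> game_value G q (f(u \<mapsto> z, v \<mapsto> y)) + K" .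
      moreover have "u \<noteq> v" using that by auto
      ultimately show ?thesis by (simp add: fun_upd_twist[of u v])
    qed
    show ?thesis
    proof (cases p)
      case Admirable
      obtain u where u: "u \<in> verts G" "u \<notin> dom (f(v \<mapsto> y))"
        "game_value G Admirable (f(v \<mapsto> y)) = game_value G Impish (f(v \<mapsto> y, u \<mapsto> 0))"
        using game_value_Admirable_optimal[OF fin nonfull'] .
      then have "u \<notin> dom (f(v \<mapsto> x))" by auto
      then show ?thesis
        using IH[of u Impish 0] u game_value_Admirable_le[OF fin, of u "f(v \<mapsto> x)"] Admirable by simp
    next
      case Impish
      obtain u where u: "u \<in> verts G" "u \<notin> dom (f(v \<mapsto> x))"
        "game_value G Impish (f(v \<mapsto> x)) = game_value G Admirable (f(v \<mapsto> x, u \<mapsto> 1))"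
        using game_value_Impish_optimal[OF fin nonfull] .
      then have "u \<notin> dom (f(v \<mapsto> y))" by auto
      then show ?thesis
        using IH[of u Admirable 1] u game_value_Impish_ge[OF fin, of u "f(v \<mapsto> y)"] Impish by simp
    qed
  qed
qed

text \<open>Admirable ignores her extra vertex \<open>v\<close>. If her strategy wants to select it, she
  takes any free vertex, which becomes the ignored one.\<close>

lemma game_value_extra_0_le:
  assumes "v \<in> verts G" "v \<notin> dom f"
  shows "game_value G p (f(v \<mapsto> 0)) \<le> game_value G p f + K"
  using assms
proof (induction "card (verts G - dom f)" arbitrary: f p v rule: less_induct)
  case less
  note v = less.prems
  have nonfull: "\<not> verts G \<subseteq> dom f" using v by auto
  have IH: "game_value G q (f(u \<mapsto> z, w \<mapsto> 0)) \<le> game_value G q (f(u \<mapsto> z)) + K"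
    if "u \<in> verts G" "u \<notin> dom f" "w \<in> verts G" "w \<notin> dom (f(u \<mapsto> z))" for u w z q
  proof -
    have "verts G - dom (f(u \<mapsto> z)) \<subset> verts G - dom f" using that by auto
    then have "card (verts G - dom (f(u \<mapsto> z))) < card (verts G - dom f)"
      using fin by (intro psubset_card_mono) auto
    from less.hyps[OF this that(3,4)] show ?thesis .
  qed
  show ?case
  proof (cases p)
    case Admirable
    obtain u where u: "u \<in> verts G" "u \<notin> dom f"
      "game_value G Admirable f = game_value G Impish (f(u \<mapsto> 0))"
      using game_value_Admirable_optimal[OF fin nonfull] .
    show ?thesis
    proof (cases "verts G \<subseteq> dom (f(v \<mapsto> 0))")
      case True
      \<comment> \<open>Her only move from \<open>f\<close> is \<open>v\<close>, so both sides reach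
        the same final labelling and nothing is lost.\<close>
      then have "u = v" using u by auto
      then show ?thesis using u True Admirable relabel_nonneg by (simp add: game_value_full)
    next
      case False
      obtain w where w: "w \<in> verts G" "w \<notin> dom (f(v \<mapsto> 0))"
        "u \<noteq> v \<Longrightarrow> w = u"
        using False u by (cases "u = v") auto
      have "game_value G Admirable (f(v \<mapsto> 0)) \<le> game_value G Impish (f(v \<mapsto> 0, w \<mapsto> 0))"
        using game_value_Admirable_le[OF fin w(1,2)] .
      also have "\<dots> \<le> game_value G Impish (f(u \<mapsto> 0)) + K"
      proof (cases "u = v")
        case True
        then show ?thesis using IH[OF v w(1,2)] by simp
      next
        case False
        then have "f(v \<mapsto> 0, w \<mapsto> 0) = f(u \<mapsto> 0, v \<mapsto> 0)" using w by (simp add: fun_upd_twist[of u v])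
        then show ?thesis using IH[OF u(1,2) v(1), of 0 Impish] v False by simp
      qed
      finally show ?thesis using u Admirable by simp
    qed
  next
    case Impish
    show ?thesis
    proof (cases "verts G \<subseteq> dom (f(v \<mapsto> 0))")
      case True
      then have full1: "verts G \<subseteq> dom (f(v \<mapsto> 1))" by auto
      \<comment> \<open>The ignored vertex is the last free one, so in the game from
        \<open>f\<close> it falls to Impish. This is the only place where \<open>K\<close> is
        actually paid.\<close>
      have "game_value G Impish (f(v \<mapsto> 0)) \<le> game_value G Admirable (f(v \<mapsto> 1)) + K"
        using relabel game_value_full[OF True] game_value_full[OF full1] by simp
      then show ?thesis using game_value_Impish_ge[OF fin v] Impish by simp
    next
      case False
      obtain u where u: "u \<in> verts G" "u \<notin> dom (f(v \<mapsto> 0))"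
        "game_value G Impish (f(v \<mapsto> 0)) = game_value G Admirable (f(v \<mapsto> 0, u \<mapsto> 1))"
        using game_value_Impish_optimal[OF fin False] .
      then have uv: "u \<noteq> v" "u \<notin> dom f" by auto
      then have "game_value G Admirable (f(v \<mapsto> 0, u \<mapsto> 1)) \<le> game_value G Admirable (f(u \<mapsto> 1)) + K"
        using IH[OF u(1) uv(2) v(1), of 1 Admirable] v uv by (simp add: fun_upd_twist[of u v])
      then show ?thesis using game_value_Impish_ge[OF fin u(1) uv(2)] u(3) Impish by simp
    qed
  qed
qed

text \<open>Admirable spends her move on any free vertex; this leaves Impish to move with one extra
  0 on the board, which harms her by at most \<open>K\<close>.\<close>

lemma game_value_Admirable_le_Impish:
  "game_value G Admirable f \<le> game_value G Impish f + K"
proof (cases "verts G \<subseteq> dom f")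
  case True
  then show ?thesis using relabel_nonneg by (simp add: game_value_full)
next
  case False
  then obtain v where v: "v \<in> verts G" "v \<notin> dom f" by blast
  then show ?thesis
    using game_value_Admirable_le[OF fin v] game_value_extra_0_le[OF v, of Impish] by simp
qed

text \<open>Admirable pretends to own \<open>v\<close>. If Impish selects it, then \<open>v\<close> is
  wrongly labelled and Admirable has gained the move, each at a cost of at most \<open>K\<close>.\<close>

lemma game_value_le_extra_0:
  assumes "v \<in> verts G" "v \<notin> dom f"
  shows "game_value G p f \<le> game_value G p (f(v \<mapsto> 0)) + 2 * K"
  using assms
proof (induction "card (verts G - dom f)" arbitrary: f p rule: less_induct)
  case less
  note v = less.prems
  have nonfull: "\<not> verts G \<subseteq> dom f" using v by auto
  have IH: "game_value G q (f(u \<mapsto> z)) \<le> game_value G q (f(v \<mapsto> 0, u \<mapsto> z)) + 2 * K"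
    if "u \<in> verts G" "u \<notin> dom f" "u \<noteq> v" for u z q
  proof -
    have "verts G - dom (f(u \<mapsto> z)) \<subset> verts G - dom f" using that by auto
    then have "card (verts G - dom (f(u \<mapsto> z))) < card (verts G - dom f)"
      using fin by (intro psubset_card_mono) auto
    from less.hyps[OF this v(1), of q] show ?thesis using v that by (simp add: fun_upd_twist[of u v])
  qed
  show ?case
  proof (cases p)
    case Admirable
    show ?thesis
    proof (cases "verts G \<subseteq> dom (f(v \<mapsto> 0))")
      case True
      then show ?thesis
        using game_value_Admirable_le[OF fin v] relabel_nonneg Admirable
        by (simp add: game_value_full)
    next
      case False
      obtain u where u: "u \<in> verts G" "u \<notin> dom (f(v \<mapsto> 0))"
        "game_value G Admirable (f(v \<mapsto> 0)) = game_value G Impish (f(v \<mapsto> 0, u \<mapsto> 0))"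
        using game_value_Admirable_optimal[OF fin False] .
      then have uv: "u \<noteq> v" "u \<notin> dom f" by auto
      show ?thesis
        using IH[OF u(1) uv(2,1), of Impish 0] game_value_Admirable_le[OF fin u(1) uv(2)]
          u(3) Admirable by simp
    qed
  next
    case Impish
    obtain u where u: "u \<in> verts G" "u \<notin> dom f"
      "game_value G Impish f = game_value G Admirable (f(u \<mapsto> 1))"
      using game_value_Impish_optimal[OF fin nonfull] .
    show ?thesis
    proof (cases "u = v")
      case True
      \<comment> \<open>From here on both positions have the same free vertices, so the induction
        hypothesis is not invoked and the loss of \<open>2 * K\<close> occurs only once.\<close>
      then show ?thesis
        using u(3) game_value_Admirable_le_Impish[of "f(v \<mapsto> 1)"]
          game_value_relabel[of Impish f v 1 0] Impish by simp
    next
      case False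
      then have "u \<notin> dom (f(v \<mapsto> 0))" using u by auto
      then show ?thesis
        using IH[OF u(1,2) False, of Admirable 1]
          game_value_Impish_ge[OF fin u(1), of "f(v \<mapsto> 0)"] u(3) Impish by simp
    qed
  qed
qed

text \<open>Admirable's optimal first move leaves Impish to move with an extra 0; withdrawing that 0
  costs at most \<open>2 * K\<close>.\<close>

lemma game_value_Impish_le_Admirable:
  "game_value G Impish f \<le> game_value G Admirable f + 2 * K"
proof (cases "verts G \<subseteq> dom f")
  case True
  then show ?thesis using relabel_nonneg by (simp add: game_value_full)
next
  case False
  obtain v where v: "v \<in> verts G" "v \<notin> dom f"
    "game_value G Admirable f = game_value G Impish (f(v \<mapsto> 0))"
    using game_value_Admirable_optimal[OF fin False] .
  then show ?thesis using game_value_le_extra_0[OF v(1,2), of Impish] by simp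
qed

end

section \<open>Cutting a graph into two parts\<close>

text \<open>Comparing the partial maps themselves, and not just labels, makes the free vertices
  agree as well. The positions are compared on actual vertices only.\<close>

definition glued :: "('a \<Rightarrow> 'c) \<Rightarrow> 'a ugraph \<Rightarrow> ('b \<Rightarrow> 'c) \<Rightarrow> 'b ugraph \<Rightarrow>
    ('c \<rightharpoonup> nat) \<Rightarrow> ('a \<rightharpoonup> nat) \<Rightarrow> ('b \<rightharpoonup> nat) \<Rightarrow> bool" where
  "glued i G j H h f g \<longleftrightarrow>
     (\<forall>x\<in>verts G. h (i x) = f x) \<and> (\<forall>y\<in>verts H. h (j y) = g y)"

text \<open>The constant \<open>c\<close> absorbs the contribution of the edges joining the two
  parts. A one-sided bound is what subadditivity calls for.\<close>

definition cut :: "int \<Rightarrow> 'c ugraph \<Rightarrow> ('a \<Rightarrow> 'c) \<Rightarrow> 'a ugraph \<Rightarrow> ('b \<Rightarrow> 'c) \<Rightarrow> 'b ugraph \<Rightarrow> bool" where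
  "cut c F i G j H \<longleftrightarrow>
     finite (verts F) \<and> finite (verts G) \<and> finite (verts H) \<and>
     inj_on i (verts G) \<and> inj_on j (verts H) \<and>
     i ` verts G \<inter> j ` verts H = {} \<and> verts F = i ` verts G \<union> j ` verts H \<and>
     (\<forall>h f g. glued i G j H h f g \<longrightarrow> discrepancy F h \<le> discrepancy G f + discrepancy H g + c)"

lemma glued_commute: "glued i G j H h f g \<longleftrightarrow> glued j H i G h g f"
  by (auto simp: glued_def)

lemma cut_commute: "cut c F i G j H \<longleftrightarrow> cut c F j H i G"
  by (auto simp: cut_def glued_commute[of j H i G] add.commute)

lemma glued_update:
  assumes "cut c F i G j H" "glued i G j H h f g" "x \<in> verts G"
  shows "glued i G j H (h(i x \<mapsto> z)) (f(x \<mapsto> z)) g"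
proof -
  have "i x' = i x \<longleftrightarrow> x' = x" if "x' \<in> verts G" for x'
    using assms(1,3) that by (auto simp: cut_def dest: inj_onD)
  moreover have "j y \<noteq> i x" if "y \<in> verts H" for y
    using assms(1,3) that unfolding cut_def by blast
  ultimately show ?thesis using assms(2) by (simp add: glued_def)
qed

text \<open>With \<open>H\<close> exhausted, the free vertices of \<open>F\<close> are exactly the
  images of those of \<open>G\<close>, so the moves in the two games correspond and only the final
  discrepancies differ, by at most the constant of the cut.\<close>

lemma game_value_cut_full:
  assumes "cut c F i G j H" "glued i G j H h f g" "verts H \<subseteq> dom g"
  shows "game_value F p h \<le> game_value G p f + discrepancy H g + c"
  using assms(2)
proof (induction "card (verts G - dom f)" arbitrary: f h p rule: less_induct)
  case less
  note glued = less.prems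
  have fin: "finite (verts F)" "finite (verts G)" using assms(1) by (auto simp: cut_def)
  have IH: "game_value F q (h(i x \<mapsto> z)) \<le> game_value G q (f(x \<mapsto> z)) + discrepancy H g + c"
    if "x \<in> verts G" "x \<notin> dom f" for x z q
  proof -
    have "verts G - dom (f(x \<mapsto> z)) \<subset> verts G - dom f" using that by auto
    then have "card (verts G - dom (f(x \<mapsto> z))) < card (verts G - dom f)"
      using fin by (intro psubset_card_mono) auto
    from less.hyps[OF this glued_update[OF assms(1) glued that(1)]] show ?thesis .
  qed
  have vF: "verts F = i ` verts G \<union> j ` verts H" using assms(1) by (simp add: cut_def)
  have dG: "i x \<in> dom h \<longleftrightarrow> x \<in> dom f" if "x \<in> verts G" for x
    using glued that by (simp add: glued_def dom_def)
  have dH: "j y \<in> dom h" if "y \<in> verts H" for y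
    using glued that assms(3) by (auto simp: glued_def dom_def)
  show ?case
  proof (cases "verts G \<subseteq> dom f")
    case True
    have "verts F \<subseteq> dom h" unfolding vF using True dG dH by blast
    then show ?thesis
      using assms(1) glued True by (simp add: game_value_full cut_def)
  next
    case False
    have nF: "\<not> verts F \<subseteq> dom h" unfolding vF using False dG by blast
    show ?thesis
    proof (cases p)
      case Admirable
      obtain x where x: "x \<in> verts G" "x \<notin> dom f"
        "game_value G Admirable f = game_value G Impish (f(x \<mapsto> 0))"
        using game_value_Admirable_optimal[OF fin(2) False] .
      then have "game_value F Admirable h \<le> game_value F Impish (h(i x \<mapsto> 0))"
        unfolding vF using dG by (intro game_value_Admirable_le[OF fin(1)]) (simp_all add: vF)
      then show ?thesis using IH[OF x(1,2), of Impish 0] x(3) Admirable by simp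
    next
      case Impish
      obtain v where v: "v \<in> verts F" "v \<notin> dom h"
        "game_value F Impish h = game_value F Admirable (h(v \<mapsto> 1))"
        using game_value_Impish_optimal[OF fin(1) nF] .
      then obtain x where x: "x \<in> verts G" "x \<notin> dom f" "v = i x"
        using dG dH unfolding vF by blast
      show ?thesis
        using IH[OF x(1,2), of Admirable 1] game_value_Impish_ge[OF fin(2) x(1,2)] v(3) x(3) Impish
        by simp
    qed
  qed
qed

text \<open>As long as Admirable can answer in the part where Impish has moved, Impish remains to
  move in both parts. When he exhausts a part, what remains is a game on the other part with
  Admirable to move; this costs \<open>K\<close>, and only once, since the induction ends
  there.\<close>

lemma game_value_cut:
  assumes "cut c F i G j H" "glued i G j H h f g"
    and "\<And>f. game_value G Admirable f \<le> game_value G Impish f + K"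
    and "\<And>g. game_value H Admirable g \<le> game_value H Impish g + K" and "0 \<le> K"
  shows "game_value F Impish h \<le> game_value G Impish f + game_value H Impish g + c + K"
  using assms(2)
proof (induction "card (verts F - dom h)" arbitrary: f g h rule: less_induct)
  case less
  note glued = less.prems
  have finF: "finite (verts F)" and vF: "verts F = i ` verts G \<union> j ` verts H"
    using assms(1) by (auto simp: cut_def)
  \<comment> \<open>Stated for an arbitrary ordered pair of parts, with the induction hypothesis as
    a premise, so that it serves for Impish's moves in \<open>G\<close> and, with the roles
    exchanged, in \<open>H\<close>.\<close>
  have reply: "game_value F Admirable (h(i' x \<mapsto> 1))
      \<le> game_value G' Impish f' + game_value H' Impish g' + c + K"
    if cut: "cut c F i' G' j' H'" and gl: "glued i' G' j' H' h f' g'"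
      and tempo: "\<And>g. game_value H' Admirable g \<le> game_value H' Impish g + K"
      and x: "x \<in> verts G'" "x \<notin> dom f'"
      and IH: "\<And>h'' f'' g''. card (verts F - dom h'') < card (verts F - dom h) \<Longrightarrow>
        glued i' G' j' H' h'' f'' g'' \<Longrightarrow>
        game_value F Impish h'' \<le> game_value G' Impish f'' + game_value H' Impish g'' + c + K"
    for i' j' f' g' x and G' :: "'x ugraph" and H' :: "'y ugraph"
  proof -
    have fin: "finite (verts G')" using cut by (simp add: cut_def)
    have vF': "verts F = i' ` verts G' \<union> j' ` verts H'" using cut by (simp add: cut_def)
    let ?h = "h(i' x \<mapsto> 1)" and ?f = "f'(x \<mapsto> 1)"
    have gl1: "glued i' G' j' H' ?h ?f g'" using glued_update[OF cut gl x(1)] .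
    have "game_value F Admirable ?h
        \<le> game_value G' Admirable ?f + game_value H' Impish g' + c + K"
    proof (cases "verts G' \<subseteq> dom ?f")
      case True
      \<comment> \<open>The part \<open>G'\<close> is exhausted, so the rest is played on
        \<open>H'\<close> with Admirable to move; \<open>tempo\<close> then hands the move to
        Impish.\<close>
      have "game_value F Admirable ?h \<le> game_value H' Admirable g' + discrepancy G' ?f + c"
        using game_value_cut_full[OF cut_commute[THEN iffD1, OF cut]
            glued_commute[THEN iffD1, OF gl1] True] .
      then show ?thesis using tempo[of g'] game_value_full[OF True, of Admirable] by simp
    next
      case False
      \<comment> \<open>The vertex \<open>u\<close> is her best reply inside \<open>G'\<close>;
        after it Impish is to move in both parts again.\<close>
      obtain u where u: "u \<in> verts G'" "u \<notin> dom ?f"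
        "game_value G' Admirable ?f = game_value G' Impish (?f(u \<mapsto> 0))"
        using game_value_Admirable_optimal[OF fin False] .
      have uF: "i' u \<in> verts F" "i' u \<notin> dom ?h" and xF: "i' x \<in> verts F" "i' x \<notin> dom h"
        using u x gl gl1 vF' by (auto simp: glued_def dom_def)
      have "verts F - dom (?h(i' u \<mapsto> 0)) \<subset> verts F - dom h" using xF by auto
      then have "card (verts F - dom (?h(i' u \<mapsto> 0))) < card (verts F - dom h)"
        using finF by (intro psubset_card_mono) auto
      from IH[OF this glued_update[OF cut gl1 u(1)]] show ?thesis
        using game_value_Admirable_le[OF finF uF] u(3) by simp
    qed
    then show ?thesis using game_value_Impish_ge[OF fin x] by simp
  qed
  show ?case
  proof (cases "verts F \<subseteq> dom h")
    case True
    then have "verts G \<subseteq> dom f" "verts H \<subseteq> dom g"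
      using glued vF by (auto simp: glued_def dom_def)
    moreover have "discrepancy F h \<le> discrepancy G f + discrepancy H g + c"
      using assms(1) glued unfolding cut_def by blast
    ultimately show ?thesis using True assms(5) by (simp add: game_value_full)
  next
    case False
    obtain v where v: "v \<in> verts F" "v \<notin> dom h"
      "game_value F Impish h = game_value F Admirable (h(v \<mapsto> 1))"
      using game_value_Impish_optimal[OF finF False] .
    consider x where "x \<in> verts G" "x \<notin> dom f" "v = i x"
      | y where "y \<in> verts H" "y \<notin> dom g" "v = j y"
      using v(1,2) glued vF by (auto simp: glued_def dom_def)
    then show ?thesis
    proof cases
      case 1
      show ?thesis
        using reply[OF assms(1) glued assms(4) 1(1,2) less.hyps] v(3) 1(3) by simp
    next
      case 2
      have "game_value F Admirable (h(j y \<mapsto> 1))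
          \<le> game_value H Impish g + game_value G Impish f + c + K"
      proof (rule reply[OF _ _ assms(3) 2(1,2)])
        show "cut c F j H i G" "glued j H i G h g f"
          using assms(1) glued cut_commute glued_commute by blast+
        show "game_value F Impish h' \<le> game_value H Impish g' + game_value G Impish f' + c + K"
          if "card (verts F - dom h') < card (verts F - dom h)" "glued j H i G h' g' f'"
          for h' g' f'
          using less.hyps[OF that(1) glued_commute[THEN iffD1, OF that(2)]] by simp
      qed
      then show ?thesis using v(3) 2(3) by simp
    qed
  qed
qed

section \<open>Paths\<close>

definition edge_sign :: "('a \<rightharpoonup> nat) \<Rightarrow> 'a set \<Rightarrow> int" where
  "edge_sign f e = (if edge_label f e = 1 then 1 else -1)"

lemma discrepancy_eq_sum:
  assumes "finite (edges G)"
  shows "discrepancy G f = (\<Sum>e\<in>edges G. edge_sign f e)"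
proof -
  have "edge_label f e = 0 \<longleftrightarrow> edge_label f e \<noteq> 1" for e
    by (auto simp: edge_label_def)
  then show ?thesis
    using assms by (simp add: discrepancy_def edge_sign_def sum.If_cases Int_def)
qed

lemma verts_path_graph [simp]: "verts (path_graph n) = {..<n}"
  by (simp add: path_graph_def verts_def)

text \<open>Edges are indexed by their left endpoint; truncated subtraction gives the empty sum for
  \<open>n = 0\<close> too.\<close>

lemma discrepancy_path_graph:
  "discrepancy (path_graph n) f = (\<Sum>i<n - 1. edge_sign f {i, Suc i})"
proof -
  have E: "edges (path_graph n) = (\<lambda>i. {i, Suc i}) ` {..<n - 1}"
    by (auto simp: path_graph_def edges_def)
  have "inj (\<lambda>i. {i, Suc i})" by (auto simp: inj_on_def doubleton_eq_iff)
  then have "inj_on (\<lambda>i. {i, Suc i}) {..<n - 1}" by (rule inj_on_subset) simp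
  then show ?thesis by (simp add: discrepancy_eq_sum E sum.reindex)
qed

text \<open>A vertex lies on at most two edges, and the sign of each changes by at most 2.\<close>

lemma discrepancy_path_graph_relabel:
  "discrepancy (path_graph n) (f(v \<mapsto> x)) \<le> discrepancy (path_graph n) (f(v \<mapsto> y)) + 4"
proof -
  \<comment> \<open>The two correction terms stand for \<open>v\<close> as left and as right
    endpoint of the edge.\<close>
  have bound: "edge_sign (f(v \<mapsto> x)) {i, Suc i} \<le> edge_sign (f(v \<mapsto> y)) {i, Suc i} +
      ((if i = v then 2 else 0) + (if Suc i = v then 2 else 0))" for i
    by (auto simp: edge_sign_def edge_label_def)
  have one: "(\<Sum>i<n - 1. if Suc i = v then 2 else 0) \<le> (2::int)"
    by (cases v) auto
  have "discrepancy (path_graph n) (f(v \<mapsto> x)) \<le> (\<Sum>i<n - 1. edge_sign (f(v \<mapsto> y)) {i, Suc i} +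
      ((if i = v then 2 else 0) + (if Suc i = v then 2 else 0)))"
    unfolding discrepancy_path_graph by (intro sum_mono bound)
  also have "\<dots> = discrepancy (path_graph n) (f(v \<mapsto> y)) +
      ((\<Sum>i<n - 1. if i = v then 2 else 0) + (\<Sum>i<n - 1. if Suc i = v then 2 else 0))"
    by (simp only: discrepancy_path_graph sum.distrib)
  also have "\<dots> \<le> discrepancy (path_graph n) (f(v \<mapsto> y)) + 4"
    using one by simp
  finally show ?thesis .
qed

lemma sum_lessThan_add:
  fixes f :: "nat \<Rightarrow> 'a::comm_monoid_add"
  shows "(\<Sum>i<m + n. f i) = (\<Sum>i<m. f i) + (\<Sum>i<n. f (m + i))"
  by (induction n) (simp_all add: add.assoc)

text \<open>The only edge lost is the one between \<open>m - 1\<close> and \<open>m\<close>, which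
  contributes at most 1.\<close>

lemma cut_path_graph:
  "cut 1 (path_graph (m + n)) id (path_graph m) ((+) m) (path_graph n)"
proof -
  have "discrepancy (path_graph (m + n)) h
      \<le> discrepancy (path_graph m) f + discrepancy (path_graph n) g + 1"
    if gl: "glued id (path_graph m) ((+) m) (path_graph n) h f g" for h f g
  proof -
    have f: "edge_sign h {i, Suc i} = edge_sign f {i, Suc i}" if "i < m - 1" for i
      using gl that by (auto simp: glued_def edge_sign_def edge_label_def)
    have g: "edge_sign h {m + i, Suc (m + i)} = edge_sign g {i, Suc i}" if "i < n - 1" for i
    proof -
      have "h (m + i) = g i" "h (m + Suc i) = g (Suc i)"
        using gl that unfolding glued_def by (auto simp del: add_Suc_right)
      then show ?thesis by (simp add: edge_sign_def edge_label_def)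
    qed
    show ?thesis
    \<comment> \<open>If a part is empty there is no joining edge, and the splitting of the index
      range below would fail because of truncated subtraction.\<close>
    proof (cases "m = 0 \<or> n = 0")
      case True
      then show ?thesis using f g by (auto simp: discrepancy_path_graph)
    next
      case False
      then have "{..<m + n - 1} = {..<(m - 1) + Suc (n - 1)}" by auto
      then have "discrepancy (path_graph (m + n)) h = (\<Sum>i<m - 1. edge_sign h {i, Suc i}) +
          (edge_sign h {m - 1, m} + (\<Sum>i<n - 1. edge_sign h {m + i, Suc (m + i)}))"
        using False by (simp only: discrepancy_path_graph sum_lessThan_add sum.lessThan_Suc_shift) simp
      also have "\<dots> = discrepancy (path_graph m) f + discrepancy (path_graph n) g +
          edge_sign h {m - 1, m}"
        using f g by (simp add: discrepancy_path_graph)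
      also have "edge_sign h {m - 1, m} \<le> 1" by (simp add: edge_sign_def)
      finally show ?thesis by simp
    qed
  qed
  moreover have "(+) m ` {..<n} = {m..<m + n}"
    by (simp add: lessThan_atLeast0 add.commute)
  ultimately show ?thesis by (auto simp: cut_def)
qed

section \<open>Bounds on the game values of paths\<close>

lemma discrepancy_path_graph_ge: "- int n \<le> discrepancy (path_graph n) f"
proof -
  have "(\<Sum>i<n - 1. -1) \<le> (\<Sum>i<n - 1. edge_sign f {i, Suc i})"
    by (intro sum_mono) (simp add: edge_sign_def)
  then show ?thesis by (simp add: discrepancy_path_graph)
qed

lemma game_value_ge:
  assumes "finite (verts G)" "\<And>f. c \<le> discrepancy G f"
  shows "c \<le> game_value G p f"
proof (induction "card (verts G - dom f)" arbitrary: f p rule: less_induct)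
  case less
  have IH: "c \<le> game_value G q (f(v \<mapsto> x))" if "v \<in> verts G" "v \<notin> dom f" for v x q
  proof -
    have "verts G - dom (f(v \<mapsto> x)) \<subset> verts G - dom f" using that by auto
    then show ?thesis using assms(1) by (intro less psubset_card_mono) auto
  qed
  show ?case
  proof (cases "verts G \<subseteq> dom f")
    case True
    then show ?thesis using assms by (simp add: game_value_full)
  next
    case False
    then show ?thesis
      using IH game_value_Admirable_optimal[OF assms(1) False]
        game_value_Impish_optimal[OF assms(1) False] by (cases p) metis+
  qed
qed

text \<open>The constant 5 is 1 for the joining edge plus 4 for the single lost tempo.\<close>

lemma balance_game_number_path_graph_add:
  "balance_game_number Impish (path_graph (m + n))
    \<le> balance_game_number Impish (path_graph m) + balance_game_number Impish (path_graph n) + 5"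
proof -
  have tempo: "game_value (path_graph k) Admirable f \<le> game_value (path_graph k) Impish f + 4" for k f
    by (intro game_value_Admirable_le_Impish discrepancy_path_graph_relabel) simp
  have "glued id (path_graph m) ((+) m) (path_graph n) Map.empty Map.empty Map.empty"
    by (simp add: glued_def)
  from game_value_cut[OF cut_path_graph this tempo tempo] show ?thesis
    by (simp add: balance_game_number_def)
qed

lemma balance_game_number_path_graph_tempo:
  "\<bar>balance_game_number Admirable (path_graph n) - balance_game_number Impish (path_graph n)\<bar> \<le> 8"
proof -
  have "balance_game_number Admirable (path_graph n) \<le> balance_game_number Impish (path_graph n) + 4"
    unfolding balance_game_number_def
    by (intro game_value_Admirable_le_Impish discrepancy_path_graph_relabel) simp
  moreover have "balance_game_number Impish (path_graph n)
      \<le> balance_game_number Admirable (path_graph n) + 2 * 4"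
    unfolding balance_game_number_def
    by (intro game_value_Impish_le_Admirable discrepancy_path_graph_relabel) simp
  ultimately show ?thesis by simp
qed

section \<open>Fekete's lemma\<close>

text \<open>For a \<open>k\<close> whose quotient is close to the infimum, division with remainder
  gives \<open>u n \<le> real q * u k + u r\<close> with \<open>r < k\<close>; the remainder term is
  bounded, so it vanishes after division by \<open>n\<close>.\<close>

lemma fekete:
  fixes u :: "nat \<Rightarrow> real"
  assumes subadd: "\<And>m n. u (m + n) \<le> u m + u n"
    and bdd: "\<And>n. 0 < n \<Longrightarrow> B \<le> u n / real n"
  shows "(\<lambda>n. u n / real n) \<longlonglongrightarrow> Inf ((\<lambda>n. u n / real n) ` {0<..})"
proof -
  let ?A = "(\<lambda>n. u n / real n) ` {0<..}"
  have bdd_below: "bdd_below ?A" using bdd by (intro bdd_belowI[of _ B]) auto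
  have mult: "u (q * k + r) \<le> real q * u k + u r" for q k r
  proof (induction q)
    case (Suc q)
    have "u (Suc q * k + r) \<le> u k + u (q * k + r)"
      using subadd[of k "q * k + r"] by (simp add: add.assoc)
    with Suc show ?case by (simp add: algebra_simps)
  qed simp
  show ?thesis
  proof (rule order_tendstoI)
    fix a assume a: "a < Inf ?A"
    have "a < u n / real n" if "0 < n" for n
      using a cInf_lower[OF _ bdd_below, of "u n / real n"] that by fastforce
    then show "\<forall>\<^sub>F n in sequentially. a < u n / real n"
      using eventually_gt_at_top[of 0] by (rule eventually_mono[rotated])
  next
    fix a assume "Inf ?A < a"
    then obtain k where k: "0 < k" "u k / real k < a"
      using cInf_lessD[of ?A a] by auto
    define s where "s = u k / real k"
    \<comment> \<open>Bounds the excess of \<open>u r\<close> over the line of slope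
      \<open>s\<close> for all possible remainders, independently of \<open>n\<close>.\<close>
    define M where "M = Max ((\<lambda>r. u r - real r * s) ` {..<k})"
    have upper: "u n / real n \<le> s + M / real n" if "0 < n" for n
    proof -
      have "u n \<le> real (n div k) * u k + u (n mod k)"
        using mult[of "n div k" k "n mod k"] by simp
      also have "u k = real k * s" using k by (simp add: s_def)
      also have "real (n div k) * (real k * s) + u (n mod k) =
          real (n div k * k + n mod k) * s + (u (n mod k) - real (n mod k) * s)"
        by (simp only: of_nat_add of_nat_mult) (simp add: algebra_simps)
      also have "\<dots> \<le> real n * s + M"
        unfolding M_def using k by (simp add: Max_ge)
      finally show ?thesis using that by (simp add: field_simps)
    qed
    have "(\<lambda>n. s + M / real n) \<longlonglongrightarrow> s + 0"
      by (intro tendsto_add tendsto_const lim_const_over_n)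
    then have "\<forall>\<^sub>F n in sequentially. s + M / real n < a"
      using k(2) by (intro order_tendstoD(2)) (auto simp: s_def)
    then show "\<forall>\<^sub>F n in sequentially. u n / real n < a"
      using eventually_gt_at_top[of 0]
      by eventually_elim (rule order.strict_trans1[OF upper])
  qed
qed

theorem theorem4p9:
  shows "\<exists>L::real.
    (\<lambda>n. real_of_int (balance_game_number Admirable (path_graph n)) / real n) \<longlonglongrightarrow> L \<and>
    (\<lambda>n. real_of_int (balance_game_number Impish (path_graph n)) / real n) \<longlonglongrightarrow> L"
proof -
  define a where "a n = real_of_int (balance_game_number Admirable (path_graph n))" for n
  define b where "b n = real_of_int (balance_game_number Impish (path_graph n))" for n
  \<comment> \<open>Adding the error constant 5 turns subadditivity up to 5 into exact
    subadditivity.\<close>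
  define u where "u n = b n + 5" for n
  have "u (m + n) \<le> u m + u n" for m n
    using balance_game_number_path_graph_add[of m n] by (simp add: u_def b_def)
  moreover have "- 1 \<le> u n / real n" if "0 < n" for n
  proof -
    have "- int n \<le> balance_game_number Impish (path_graph n)"
      unfolding balance_game_number_def by (intro game_value_ge discrepancy_path_graph_ge) simp
    then show ?thesis using that by (simp add: u_def b_def field_simps)
  qed
  ultimately obtain L where L: "(\<lambda>n. u n / real n) \<longlonglongrightarrow> L" using fekete by blast
  have "(\<lambda>n. u n / real n - 5 / real n) \<longlonglongrightarrow> L - 0"
    by (intro tendsto_diff L lim_const_over_n)
  then have b: "(\<lambda>n. b n / real n) \<longlonglongrightarrow> L" by (simp add: u_def add_divide_distrib)
  \<comment> \<open>The two values differ by at most 8, so their quotients by \<open>n\<close> share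
    the limit.\<close>
  have "(\<lambda>n. (a n - b n) / real n) \<longlonglongrightarrow> 0"
  proof (rule tendsto_0_le[where K = 1])
    have "\<bar>a n - b n\<bar> \<le> 8" for n
      using balance_game_number_path_graph_tempo[of n] by (simp add: a_def b_def)
    then show "\<forall>\<^sub>F n in sequentially. norm ((a n - b n) / real n) \<le> norm (8 / real n) * 1"
      by (auto simp: divide_right_mono)
  qed (rule lim_const_over_n)
  from tendsto_add[OF this b] have "(\<lambda>n. a n / real n) \<longlonglongrightarrow> L" by (simp add: diff_divide_distrib)
  with b show ?thesis unfolding a_def b_def by blast
qed

end
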